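(* Let $G$ be a finite graph on the node set $V=\{1,\dots,n\}$ with initial colors $c^{(0)}$, let $G_1,G_2\in\mathcal{N}^{\infty}_G(c^{(0)})$, where color refinement (CR) aggregates over the in-neighbors (except in items 4 and 5, where the CR variant is as indicated there), and let $A_1,A_2$ be the adjacency matrices of $G_1,G_2$. Let $u$ be a node of $G_i$ and $v$ a node of $G_j$, with $i,j\in\{1,2\}$, having the same color $c^{(\infty)}(u)=c^{(\infty)}(v)$. Write $\Gamma(u)$ for the centrality of $u$ in $G_i$ and $\Gamma(v)$ for the centrality of $v$ in $G_j$. Then: 1. $\Gamma_{\mathbf{Katz}}(u)=\Gamma_{\mathbf{Katz}}(v)$. 2. $\Gamma_{\mathbf{EV}}(u)=\Gamma_{\mathbf{EV}}(v)$. 3. If $c^{(0)}$ refines the out-degree $\deg_{\mathrm{out}}$ (that is, nodes of $G_1$ and $G_2$ with equal initial color have equal out-degree, within and across the two graphs), then $\Gamma_{\mathbf{PR}}(u)=\Gamma_{\mathbf{PR}}(v)$. 4. If instead the colors are computed by CR on the (weighted) graphs with adjacency matrices $A_\ell^\top A_\ell$ for $\ell=1,2$, then $\Gamma_{\mathbf{auth}}(u)=\Gamma_{\mathbf{auth}}(v)$. 5. If instead CR aggregates over both in- and out-neighbors, then $\Gamma_{\mathbf{auth}}(u)=\Gamma_{\mathbf{auth}}(v)$ and $\Gamma_{\mathbf{hub}}(u)=\Gamma_{\mathbf{hub}}(v)$.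
   Context: Graphs: the adjacency matrix $A\in\{0,1\}^{n\times n}$ has $A_{xy}=1$ iff $xy\in E$. $N_{\mathrm{in}}(v)=\{x:xv\in E\}$, $N_{\mathrm{out}}(v)=\{x:vx\in E\}$; undirected graphs are those with symmetric $A$. $\deg_{\mathrm{out}}(v)=|N_{\mathrm{out}}(v)|$. Color refinement: fix an injective function $\operatorname{hash}$, the same for all graphs and iterations. Starting from $c^{(0)}$, CR over in-neighbors is $c^{(t+1)}(v)=\operatorname{hash}\big(c^{(t)}(v),\{\{c^{(t)}(x):x\in N_{\mathrm{in}}(v)\}\}\big)$, with $\{\{\cdot\}\}$ a multiset. CR over both in- and out-neighbors is $c^{(t+1)}(v)=\operatorname{hash}\big(c^{(t)}(v),\{\{c^{(t)}(x):x\in N_{\mathrm{in}}(v)\}\},\{\{c^{(t)}(x):x\in N_{\mathrm{out}}(v)\}\}\big)$. CR on the weighted graph with nonnegative integer adjacency matrix $M$ uses the in-neighbor rule in which each $x$ is counted with multiplicity $M_{xv}$. The equality $c^{(\infty)}(u)=c^{(\infty)}(v)$ means $c^{(t)}(u)=c^{(t)}(v)$ for all $t\ge 0$, i.e. equality of the colors at and beyond stabilization of the color partition. $\mathcal{N}^\infty_G(c^{(0)})$ is the set of labeled graphs $G'$ on $V$ that have the same CR colors as $G$ at every depth: $c^{(t)}_{G'}(v)=c^{(t)}_{G}(v)$ for all $v\in V$ and all $t\ge 0$, with respect to the CR variant in use. Centralities: for a square matrix $M_X$ with $|\lambda_{\max}|=\max_{\lambda\in\operatorname{spec}(M_X)}|\lambda|$,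 let $$\Gamma_{X}=\lim_{m\to\infty}\frac1m\sum_{i=0}^m\big(|\lambda_{\max}|^{-1}M_X\big)^i\mathbb{1},$$ where $\mathbb{1}$ is the all-ones vector; the equalities in the claim are for centralities that are defined (i.e. $|\lambda_{\max}|>0$ and the limit exists). The matrices are: - eigenvector centrality $\Gamma_{\mathbf{EV}}$: $M_{\mathbf{EV}}=A^\top$; - PageRank $\Gamma_{\mathbf{PR}}$: $M_{\mathbf{PR}}=\alpha\bar A^\top D^{-1}+(1-\alpha)\frac1n\mathbb{1}\mathbb{1}^\top$, where $\alpha\in[0,1]$ is a damping parameter (the same for both graphs), $\bar A$ is the adjacency matrix of the augmented graph in which each node of out-degree zero is connected to all nodes, and $D=\operatorname{diag}(\bar A\mathbb{1})$; - HITS authority and hub scores $\Gamma_{\mathbf{auth}},\Gamma_{\mathbf{hub}}$: $M_{\mathbf{auth}}=A^\top A$, $M_{\mathbf{hub}}=AA^\top$. Katz centrality is $\Gamma_{\mathbf{Katz}}=\sum_{k=0}^\infty a^k(A^k)^\top\mathbb{1}$, with a parameter $a>0$ (the same for both graphs) satisfying $\frac1a>\max_{\lambda\in\operatorname{spec}(A)}|\lambda|$. *)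

theory Defs
  imports "Jordan_Normal_Form.Spectral_Radius" "HOL-Library.Multiset"
begin

text \<open>
  A (directed) graph on n nodes is an edge relation on the node set {0..<n}, so that nodes are
  the row and column indices of the adjacency matrix.  Loops are allowed.
\<close>

type_synonym graph = "(nat \<times> nat) set"

definition is_graph :: "nat \<Rightarrow> graph \<Rightarrow> bool" where
  "is_graph n E \<longleftrightarrow> E \<subseteq> {0..<n} \<times> {0..<n}"

definition adj :: "nat \<Rightarrow> graph \<Rightarrow> 'a::zero_neq_one mat" where
  "adj n E = mat n n (\<lambda>(x, y). of_bool ((x, y) \<in> E))"

definition N_in :: "graph \<Rightarrow> nat \<Rightarrow> nat set" where
  "N_in E v = {x. (x, v) \<in> E}"

definition N_out :: "graph \<Rightarrow> nat \<Rightarrow> nat set" where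
  "N_out E v = {x. (v, x) \<in> E}"

definition deg_out :: "graph \<Rightarrow> nat \<Rightarrow> nat" where
  "deg_out E v = card (N_out E v)"


subsection \<open>Color refinement\<close>

definition mset_image :: "(nat \<Rightarrow> 'c) \<Rightarrow> nat set \<Rightarrow> 'c multiset" where
  "mset_image c X = {# c x. x \<in># mset_set X #}"

primrec cr_in :: "('c \<times> 'c multiset \<Rightarrow> 'c) \<Rightarrow> (nat \<Rightarrow> 'c) \<Rightarrow> graph \<Rightarrow> nat \<Rightarrow> nat \<Rightarrow> 'c" where
  "cr_in hash c0 E 0 = c0"
| "cr_in hash c0 E (Suc t) =
     (\<lambda>v. hash (cr_in hash c0 E t v, mset_image (cr_in hash c0 E t) (N_in E v)))"

primrec cr_in_out ::
  "('c \<times> 'c multiset \<times> 'c multiset \<Rightarrow> 'c) \<Rightarrow> (nat \<Rightarrow> 'c) \<Rightarrow> graph \<Rightarrow> nat \<Rightarrow> nat \<Rightarrow> 'c" where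
  "cr_in_out hash c0 E 0 = c0"
| "cr_in_out hash c0 E (Suc t) =
     (\<lambda>v. hash (cr_in_out hash c0 E t v,
                mset_image (cr_in_out hash c0 E t) (N_in E v),
                mset_image (cr_in_out hash c0 E t) (N_out E v)))"

primrec cr_weighted ::
  "('c \<times> 'c multiset \<Rightarrow> 'c) \<Rightarrow> (nat \<Rightarrow> 'c) \<Rightarrow> nat mat \<Rightarrow> nat \<Rightarrow> nat \<Rightarrow> 'c" where
  "cr_weighted hash c0 M 0 = c0"
| "cr_weighted hash c0 M (Suc t) =
     (\<lambda>v. hash (cr_weighted hash c0 M t v,
                \<Sum>x = 0..<dim_row M. replicate_mset (M $$ (x, v)) (cr_weighted hash c0 M t x)))"

definition cr_gram :: "nat \<Rightarrow> ('c \<times> 'c multiset \<Rightarrow> 'c) \<Rightarrow> (nat \<Rightarrow> 'c) \<Rightarrow> graph \<Rightarrow> nat \<Rightarrow> nat \<Rightarrow> 'c" where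
  "cr_gram n hash c0 E = cr_weighted hash c0 (transpose_mat (adj n E) * adj n E)"

text \<open>
  In the next two definitions the argument CR is a variant of color refinement with its
  initial colors already supplied; CR E t v is the color of node v of the graph E at depth t.
\<close>

definition cr_nbhd :: "nat \<Rightarrow> (graph \<Rightarrow> nat \<Rightarrow> nat \<Rightarrow> 'c) \<Rightarrow> graph \<Rightarrow> graph set" where
  "cr_nbhd n CR E = {E'. is_graph n E' \<and> (\<forall>v<n. \<forall>t. CR E' t v = CR E t v)}"

definition same_color :: "(graph \<Rightarrow> nat \<Rightarrow> nat \<Rightarrow> 'c) \<Rightarrow> graph \<Rightarrow> nat \<Rightarrow> graph \<Rightarrow> nat \<Rightarrow> bool" where
  "same_color CR E u E' v \<longleftrightarrow> (\<forall>t. CR E t u = CR E' t v)"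


subsection \<open>Centralities\<close>

definition ones :: "nat \<Rightarrow> real vec" where
  "ones n = vec n (\<lambda>_. 1)"

text \<open>The spectrum of a real matrix is taken over the complex numbers.\<close>

definition lam_max :: "real mat \<Rightarrow> real" where
  "lam_max M = spectral_radius (map_mat complex_of_real M)"

definition cesaro :: "real mat \<Rightarrow> nat \<Rightarrow> nat \<Rightarrow> real" where
  "cesaro M x m =
     1 / real m * (\<Sum>i = 0..m. (((1 / lam_max M) \<cdot>\<^sub>m M) ^\<^sub>m i *\<^sub>v ones (dim_row M)) $ x)"

text \<open>The limit of vectors is the entrywise one.\<close>

definition centrality_defined :: "real mat \<Rightarrow> bool" where
  "centrality_defined M \<longleftrightarrow> lam_max M > 0 \<and> (\<forall>x<dim_row M. convergent (cesaro M x))"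

definition centrality :: "real mat \<Rightarrow> nat \<Rightarrow> real" where
  "centrality M x = lim (cesaro M x)"

definition M_EV :: "nat \<Rightarrow> graph \<Rightarrow> real mat" where
  "M_EV n E = transpose_mat (adj n E)"

definition M_auth :: "nat \<Rightarrow> graph \<Rightarrow> real mat" where
  "M_auth n E = transpose_mat (adj n E) * adj n E"

definition M_hub :: "nat \<Rightarrow> graph \<Rightarrow> real mat" where
  "M_hub n E = adj n E * transpose_mat (adj n E)"

definition augment :: "nat \<Rightarrow> graph \<Rightarrow> graph" where
  "augment n E = E \<union> {(x, y). x < n \<and> y < n \<and> deg_out E x = 0}"

text \<open>
  The inverse of the diagonal degree matrix D is written entrywise; the row sums of the
  augmented adjacency matrix are positive.
\<close>

definition M_PR :: "real \<Rightarrow> nat \<Rightarrow> graph \<Rightarrow> real mat" where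
  "M_PR \<alpha> n E =
     (let A = adj n (augment n E);
          D_inv = mat_diag n (\<lambda>x. 1 / (A *\<^sub>v ones n) $ x)
      in \<alpha> \<cdot>\<^sub>m (transpose_mat A * D_inv) + ((1 - \<alpha>) * (1 / real n)) \<cdot>\<^sub>m mat n n (\<lambda>_. 1))"

definition katz :: "real \<Rightarrow> nat \<Rightarrow> graph \<Rightarrow> nat \<Rightarrow> real" where
  "katz a n E x = (\<Sum>k. a ^ k * (transpose_mat (adj n E ^\<^sub>m k) *\<^sub>v ones n) $ x)"

end

theory Submission
  imports Defs
begin

text \<open>
  Each matrix involved is nonnegative and sends a vector that is a function of the colors at some
  depth, the same function in all graphs, to a vector of the same kind, so this holds for its powers
  applied to the all-ones vector.  Hence these powers are literally equal for two graphs with the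
  same colors at every node.  As the growth of \<open>M\<^sup>i \<one>\<close> determines the spectral radius
  of a nonnegative matrix, the normalizing factors of the centralities agree, too.
\<close>

section \<open>Powers of a matrix applied to a vector\<close>

lemma ones_carrier [simp]: "ones n \<in> carrier_vec n"
  by (simp add: ones_def)

lemma adj_carrier [simp]: "adj n E \<in> carrier_mat n n"
  by (simp add: adj_def)

lemma adj_index: "x < n \<Longrightarrow> y < n \<Longrightarrow> adj n E $$ (x, y) = of_bool ((x, y) \<in> E)"
  by (simp add: adj_def)

lemma adj_dim [simp]: "dim_row (adj n E) = n" "dim_col (adj n E) = n"
  by (simp_all add: adj_def)

lemma pow_mat_Suc_left:
  fixes A :: "'a :: comm_semiring_1 mat"
  assumes A: "A \<in> carrier_mat n n"
  shows "A ^\<^sub>m Suc k = A * A ^\<^sub>m k"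
proof (induction k)
  case 0
  then show ?case using A by simp
next
  case (Suc k)
  then show ?case using A by (simp add: assoc_mult_mat[of _ n n _ n _ n])
qed

lemma transpose_pow_mat:
  fixes A :: "'a :: comm_semiring_1 mat"
  assumes A: "A \<in> carrier_mat n n"
  shows "transpose_mat (A ^\<^sub>m k) = transpose_mat A ^\<^sub>m k"
proof (induction k)
  case 0
  then show ?case using A by simp
next
  case (Suc k)
  have "transpose_mat (A ^\<^sub>m Suc k) = transpose_mat (A * A ^\<^sub>m k)"
    by (simp only: pow_mat_Suc_left[OF A])
  also have "\<dots> = transpose_mat (A ^\<^sub>m k) * transpose_mat A"
    using A by (intro transpose_mult) auto
  finally show ?case using Suc.IH by simp
qed

text \<open>Peeling the new factor off on the left, \<open>M * M ^\<^sub>m i\<close>, exposes one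
  application of \<open>M\<close> to the previous iterate. This is the recursion on which all
  inductions over powers run.\<close>

lemma pow_mat_Suc_mult_vec_index:
  fixes M :: "'a :: comm_semiring_1 mat"
  assumes "M \<in> carrier_mat n n" and "v \<in> carrier_vec n" and "x < n"
  shows "(M ^\<^sub>m Suc i *\<^sub>v v) $ x = (\<Sum>y<n. M $$ (x, y) * (M ^\<^sub>m i *\<^sub>v v) $ y)"
proof -
  have "M ^\<^sub>m Suc i *\<^sub>v v = M *\<^sub>v (M ^\<^sub>m i *\<^sub>v v)"
    using assms by (simp only: pow_mat_Suc_left) (simp add: assoc_mult_mat_vec[of _ n n _ n])
  then have "(M ^\<^sub>m Suc i *\<^sub>v v) $ x = (M *\<^sub>v (M ^\<^sub>m i *\<^sub>v v)) $ x"
    by simp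
  also have "\<dots> = (\<Sum>y<n. M $$ (x, y) * (M ^\<^sub>m i *\<^sub>v v) $ y)"
    using assms by (simp add: scalar_prod_def[of _ "_ *\<^sub>v _"] lessThan_atLeast0 del: index_mult_mat_vec)
      (simp add: scalar_prod_def)
  finally show ?thesis .
qed

lemma mult_ones_index:
  assumes "M \<in> carrier_mat n n" and "x < n"
  shows "(M *\<^sub>v ones n) $ x = (\<Sum>y<n. M $$ (x, y))"
  using assms by (simp add: scalar_prod_def ones_def lessThan_atLeast0)

text \<open>Separates the normalizing factor of a centrality from the unnormalized powers, so that
  the two can be compared independently.\<close>

lemma pow_smult_mat_mult_vec_index:
  fixes M :: "'a :: comm_semiring_1 mat"
  assumes M: "M \<in> carrier_mat n n" and v: "v \<in> carrier_vec n" and x: "x < n"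
  shows "((c \<cdot>\<^sub>m M) ^\<^sub>m i *\<^sub>v v) $ x = c ^ i * (M ^\<^sub>m i *\<^sub>v v) $ x"
  using x
proof (induction i arbitrary: x)
  case 0
  then show ?case using M v by simp
next
  case (Suc i)
  have "((c \<cdot>\<^sub>m M) ^\<^sub>m Suc i *\<^sub>v v) $ x
      = (\<Sum>y<n. (c \<cdot>\<^sub>m M) $$ (x, y) * ((c \<cdot>\<^sub>m M) ^\<^sub>m i *\<^sub>v v) $ y)"
    using M v Suc.prems by (intro pow_mat_Suc_mult_vec_index) auto
  also have "\<dots> = (\<Sum>y<n. c ^ Suc i * (M $$ (x, y) * (M ^\<^sub>m i *\<^sub>v v) $ y))"
    using M Suc.prems by (intro sum.cong) (auto simp: Suc.IH mult_ac simp del: index_mult_mat_vec)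
  also have "\<dots> = c ^ Suc i * (M ^\<^sub>m Suc i *\<^sub>v v) $ x"
    by (simp only: pow_mat_Suc_mult_vec_index[OF M v Suc.prems] sum_distrib_left)
  finally show ?case .
qed

lemma pow_mat_nonneg:
  fixes M :: "real mat"
  assumes M: "M \<in> carrier_mat n n" and nonneg: "\<And>x y. x < n \<Longrightarrow> y < n \<Longrightarrow> 0 \<le> M $$ (x, y)"
  shows "x < n \<Longrightarrow> y < n \<Longrightarrow> 0 \<le> (M ^\<^sub>m i) $$ (x, y)"
proof (induction i arbitrary: x y)
  case 0
  then show ?case using M by simp
next
  case (Suc i)
  have [simp]: "dim_row M = n" "dim_col M = n" using M by auto
  show ?case using Suc nonneg by (auto simp: scalar_prod_def intro!: sum_nonneg)
qed


subsection \<open>Spectral radius and growth of powers\<close>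

text \<open>An eigenvector of the scaled matrix for \<open>\<mu>\<close> is an eigenvector of
  \<open>A\<close> for \<open>r * \<mu>\<close>. Taking \<open>\<mu>\<close> of maximal modulus
  gives \<open>r * norm \<mu> \<le> spectral_radius A < r\<close>.\<close>

lemma spectral_radius_smult_less_1:
  fixes A :: "complex mat" and r :: real
  assumes A: "A \<in> carrier_mat n n" and n: "n > 0" and r: "spectral_radius A < r" "0 < r"
  shows "spectral_radius (complex_of_real (1 / r) \<cdot>\<^sub>m A) < 1"
proof -
  let ?B = "complex_of_real (1 / r) \<cdot>\<^sub>m A"
  have B: "?B \<in> carrier_mat n n" using A by simp
  obtain \<mu> where \<mu>: "\<mu> \<in> spectrum ?B" "spectral_radius ?B = norm \<mu>"
    using spectral_radius_mem_max(1)[OF B n] by auto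
  then obtain w where w: "w \<in> carrier_vec n" "w \<noteq> 0\<^sub>v n" "?B *\<^sub>v w = \<mu> \<cdot>\<^sub>v w"
    using B unfolding spectrum_def eigenvalue_def eigenvector_def by auto
  have "A *\<^sub>v w = (of_real r * \<mu>) \<cdot>\<^sub>v w"
  proof (rule eq_vecI)
    fix i assume "i < dim_vec ((of_real r * \<mu>) \<cdot>\<^sub>v w)"
    then have i: "i < n" using w by simp
    have "(?B *\<^sub>v w) $ i = (\<mu> \<cdot>\<^sub>v w) $ i" using w by simp
    then have "of_real (1 / r) * (A *\<^sub>v w) $ i = \<mu> * w $ i"
      using A w i by (simp add: scalar_prod_def sum_distrib_left mult_ac)
    then show "(A *\<^sub>v w) $ i = ((of_real r * \<mu>) \<cdot>\<^sub>v w) $ i"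
      using r i w by (simp add: field_simps)
  qed (use A w in auto)
  then have "of_real r * \<mu> \<in> spectrum A"
    using w A unfolding spectrum_def eigenvalue_def eigenvector_def by auto
  then have "norm (of_real r * \<mu>) \<le> spectral_radius A"
    by (intro spectral_radius_mem_max(2)[OF A n]) auto
  then have "r * norm \<mu> \<le> spectral_radius A" using r by (simp add: norm_mult)
  then have "r * norm \<mu> < r * 1" using r by linarith
  then show ?thesis using r(2) \<mu>(2) by (simp only: mult_less_cancel_left_pos)
qed

lemma lam_max_nonneg:
  assumes "M \<in> carrier_mat n n" and "n > 0"
  shows "0 \<le> lam_max M"
  using spectral_radius_mem_max(1)[of "map_mat complex_of_real M" n] assms
  by (auto simp: lam_max_def)

text \<open>The matrix scaled by \<open>1 / r\<close> has spectral radius below 1, so the Jordan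
  normal form bounds the entries of all its powers by one constant. Summing a row of
  \<open>n\<close> such entries and undoing the scaling gives the growth bound.\<close>

lemma pow_mat_ones_bound:
  assumes M: "M \<in> carrier_mat n n" and n: "n > 0" and r: "lam_max M < r"
  obtains c where "\<And>i x. x < n \<Longrightarrow> (M ^\<^sub>m i *\<^sub>v ones n) $ x \<le> c * r ^ i"
proof -
  have r0: "r > 0" using lam_max_nonneg[OF M n] r by simp
  let ?N = "(1 / r) \<cdot>\<^sub>m M"
  have N: "?N \<in> carrier_mat n n" using M by simp
  have eq: "complex_of_real (1 / r) \<cdot>\<^sub>m map_mat complex_of_real M = map_mat complex_of_real ?N"
    using M by (intro eq_matI) auto
  have "spectral_radius (map_mat complex_of_real ?N) < 1"
    using spectral_radius_smult_less_1[of "map_mat complex_of_real M" n r] M n r r0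
    by (simp add: lam_max_def eq[symmetric])
  then obtain c where c: "\<And>k. norm_bound (map_mat complex_of_real ?N ^\<^sub>m k) c"
    using spectral_radius_jnf_norm_bound_less_1_upper_triangular[of "map_mat complex_of_real ?N" n] N
    by auto
  have entry: "\<bar>(?N ^\<^sub>m k) $$ (x, y)\<bar> \<le> c" if "x < n" "y < n" for k x y
  proof -
    have "norm ((map_mat complex_of_real (?N ^\<^sub>m k)) $$ (x, y)) \<le> c"
      using c[of k] that M
      unfolding norm_bound_def of_real_hom.mat_hom_pow[OF N, symmetric] by auto
    then show ?thesis using that M by simp
  qed
  show thesis
  proof
    fix i x assume x: "x < n"
    have "(?N ^\<^sub>m i *\<^sub>v ones n) $ x = (\<Sum>y<n. (?N ^\<^sub>m i) $$ (x, y))"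
      using N x by (intro mult_ones_index) auto
    also have "\<dots> \<le> (\<Sum>y<n. c)"
      using entry[OF x] by (intro sum_mono) (auto dest: abs_le_D1)
    finally have "(1 / r) ^ i * (M ^\<^sub>m i *\<^sub>v ones n) $ x \<le> real n * c"
      using pow_smult_mat_mult_vec_index[OF M ones_carrier x] by simp
    then show "(M ^\<^sub>m i *\<^sub>v ones n) $ x \<le> (real n * c) * r ^ i"
      using r0 by (simp add: field_simps power_divide)
  qed
qed

text \<open>A possibly complex eigenvector \<open>z\<close> for an eigenvalue of maximal modulus
  satisfies \<open>norm \<mu> ^ i * norm (z $ x) = norm ((M^i z) $ x)\<close>. As \<open>M\<close>
  is nonnegative, the right side is at most a constant times the row sum of \<open>M^i\<close>. Any
  coordinate \<open>x\<close> with \<open>z $ x \<noteq> 0\<close> serves as witness.\<close>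

lemma pow_mat_ones_lower_bound:
  assumes M: "M \<in> carrier_mat n n" and n: "n > 0"
    and nonneg: "\<And>x y. x < n \<Longrightarrow> y < n \<Longrightarrow> 0 \<le> M $$ (x, y)"
  obtains d x where "0 < d" and "x < n"
    and "\<And>i. d * lam_max M ^ i \<le> (M ^\<^sub>m i *\<^sub>v ones n) $ x"
proof -
  let ?A = "map_mat complex_of_real M"
  have A: "?A \<in> carrier_mat n n" using M by simp
  obtain \<mu> where \<mu>: "\<mu> \<in> spectrum ?A" "lam_max M = norm \<mu>"
    using spectral_radius_mem_max(1)[OF A n] by (auto simp: lam_max_def)
  then obtain z where z: "eigenvector ?A z \<mu>"
    unfolding spectrum_def eigenvalue_def by auto
  then have zc: "z \<in> carrier_vec n" and "z \<noteq> 0\<^sub>v n"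
    using M unfolding eigenvector_def by auto
  then obtain x where x: "x < n" "z $ x \<noteq> 0"
    by (metis carrier_vecD eq_vecI index_zero_vec)
  \<comment> \<open>The sum is a convenient upper bound for all moduli \<open>norm (z $ y)\<close>,
    and it is positive because of the coordinate \<open>x\<close>.\<close>
  define C where "C = (\<Sum>y<n. norm (z $ y))"
  have le_C: "norm (z $ y) \<le> C" if "y < n" for y
    unfolding C_def using that by (intro member_le_sum) auto
  have C: "C > 0"
    using le_C[OF x(1)] x(2) by (metis norm_le_zero_iff not_le order_trans)
  have bound: "norm \<mu> ^ i * norm (z $ x) \<le> C * (M ^\<^sub>m i *\<^sub>v ones n) $ x" for i
  proof -
    have P: "M ^\<^sub>m i \<in> carrier_mat n n" using M by simp
    have "(?A ^\<^sub>m i *\<^sub>v z) $ x = (\<mu> ^ i \<cdot>\<^sub>v z) $ x"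
      using eigenvector_pow[OF A z] by simp
    then have "\<mu> ^ i * z $ x = (map_mat complex_of_real (M ^\<^sub>m i) *\<^sub>v z) $ x"
      using x zc by (simp add: of_real_hom.mat_hom_pow[OF M])
    also have "\<dots> = (\<Sum>y<n. of_real ((M ^\<^sub>m i) $$ (x, y)) * z $ y)"
      using P x zc M by (simp add: scalar_prod_def lessThan_atLeast0)
    finally have "norm \<mu> ^ i * norm (z $ x) = norm (\<Sum>y<n. of_real ((M ^\<^sub>m i) $$ (x, y)) * z $ y)"
      by (metis norm_mult norm_power)
    also have "\<dots> \<le> (\<Sum>y<n. norm (of_real ((M ^\<^sub>m i) $$ (x, y)) * z $ y))"
      by (rule norm_sum)
    \<comment> \<open>Nonnegativity of \<open>M\<close> enters here: the entries of its powers equal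
      their absolute values.\<close>
    also have "\<dots> \<le> (\<Sum>y<n. C * (M ^\<^sub>m i) $$ (x, y))"
      using pow_mat_nonneg[OF M nonneg x(1)] le_C
      by (intro sum_mono) (auto simp: norm_mult mult.commute intro!: mult_right_mono)
    finally show ?thesis
      by (simp only: mult_ones_index[OF P x(1)] sum_distrib_left)
  qed
  show thesis
  proof
    show "0 < norm (z $ x) / C" using x C by simp
    show "norm (z $ x) / C * lam_max M ^ i \<le> (M ^\<^sub>m i *\<^sub>v ones n) $ x" for i
      using bound[of i] C \<mu> by (simp add: field_simps)
  qed (fact x)
qed

text \<open>Otherwise pick \<open>r\<close> strictly between the two radii. Some coordinate of the
  iterates of \<open>M\<close> grows at least like \<open>lam_max M ^ i\<close>, while those of
  \<open>N\<close> grow at most like \<open>r ^ i\<close>; for large \<open>i\<close> this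
  contradicts \<open>le\<close>.\<close>

lemma lam_max_mono:
  assumes M: "M \<in> carrier_mat n n" and N: "N \<in> carrier_mat n n" and n: "n > 0"
    and nonneg: "\<And>x y. x < n \<Longrightarrow> y < n \<Longrightarrow> 0 \<le> M $$ (x, y)"
    and le: "\<And>i x. x < n \<Longrightarrow> (M ^\<^sub>m i *\<^sub>v ones n) $ x \<le> (N ^\<^sub>m i *\<^sub>v ones n) $ x"
  shows "lam_max M \<le> lam_max N"
proof (rule ccontr)
  assume "\<not> ?thesis"
  then obtain r where r: "lam_max N < r" "r < lam_max M"
    using dense[of "lam_max N" "lam_max M"] by auto
  have r0: "r > 0" using lam_max_nonneg[OF N n] r by simp
  obtain c where c: "\<And>i x. x < n \<Longrightarrow> (N ^\<^sub>m i *\<^sub>v ones n) $ x \<le> c * r ^ i"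
    using pow_mat_ones_bound[OF N n r(1)] by blast
  obtain d x where d: "0 < d" "x < n"
    "\<And>i. d * lam_max M ^ i \<le> (M ^\<^sub>m i *\<^sub>v ones n) $ x"
    using pow_mat_ones_lower_bound[OF M n nonneg] by blast
  have "1 < lam_max M / r" using r r0 by simp
  then obtain i where i: "c / d < (lam_max M / r) ^ i"
    using real_arch_pow by blast
  have "d * lam_max M ^ i \<le> c * r ^ i"
    using d(3)[of i] le[OF d(2), of i] c[OF d(2), of i] by linarith
  then have "(lam_max M / r) ^ i \<le> c / d"
    using r0 d(1) by (simp add: field_simps power_divide)
  then show False using i by simp
qed


subsection \<open>Functions of the colors\<close>

text \<open>The depth \<open>t\<close> and the function \<open>F\<close> are shared by all graphs of
  \<open>S\<close> and all nodes; this uniformity is what permits comparisons across graphs. A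
  finite depth stands in for the stable coloring.\<close>

definition color_fun ::
  "nat \<Rightarrow> (graph \<Rightarrow> nat \<Rightarrow> nat \<Rightarrow> 'c) \<Rightarrow> graph set \<Rightarrow> (graph \<Rightarrow> nat \<Rightarrow> 'b) \<Rightarrow> bool" where
  "color_fun n CR S w \<longleftrightarrow> (\<exists>t F. \<forall>H\<in>S. \<forall>x<n. w H x = F (CR H t x))"

text \<open>A color determines its predecessor through a map \<open>g\<close> that depends neither
  on the graph nor on the depth, so \<open>g\<close> can be iterated to reach any earlier
  depth.\<close>

definition refining :: "(graph \<Rightarrow> nat \<Rightarrow> nat \<Rightarrow> 'c) \<Rightarrow> bool" where
  "refining CR \<longleftrightarrow> (\<exists>g. \<forall>H t x. CR H t x = g (CR H (Suc t) x))"

lemma refining_le: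
  assumes "refining CR" and "t \<le> t'"
  obtains g where "\<And>H x. CR H t x = g (CR H t' x)"
proof -
  obtain g where g: "\<And>H t x. CR H t x = g (CR H (Suc t) x)"
    using assms(1) unfolding refining_def by blast
  have "CR H t x = (g ^^ k) (CR H (t + k) x)" for k H x
  proof (induction k)
    case (Suc k)
    then show ?case using g[of H "t + k" x] by (simp add: funpow_swap1)
  qed simp
  from this[of _ _ "t' - t"] show thesis using that assms(2) by auto
qed

lemma color_fun_const: "color_fun n CR S (\<lambda>H x. c)"
  unfolding color_fun_def by (intro exI[of _ "\<lambda>_. c"] exI[of _ 0]) simp

text \<open>The two functions may live at different depths; both are read off from the colors at the
  larger one.\<close>

lemma color_fun_map2:
  assumes "refining CR" and "color_fun n CR S w" and "color_fun n CR S w'"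
  shows "color_fun n CR S (\<lambda>H x. f (w H x) (w' H x))"
proof -
  obtain t F where F: "\<forall>H\<in>S. \<forall>x<n. w H x = F (CR H t x)"
    using assms(2) unfolding color_fun_def by blast
  obtain t' F' where F': "\<forall>H\<in>S. \<forall>x<n. w' H x = F' (CR H t' x)"
    using assms(3) unfolding color_fun_def by blast
  obtain g where g: "\<And>H x. CR H t x = g (CR H (max t t') x)"
    using refining_le[OF assms(1), of t "max t t'"] by auto
  obtain g' where g': "\<And>H x. CR H t' x = g' (CR H (max t t') x)"
    using refining_le[OF assms(1), of t' "max t t'"] by auto
  have "\<forall>H\<in>S. \<forall>x<n. f (w H x) (w' H x) = (\<lambda>c. f (F (g c)) (F' (g' c))) (CR H (max t t') x)"
    using F F' g g' by simp
  then show ?thesis unfolding color_fun_def by (intro exI)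
qed

lemma color_fun_cong:
  assumes "color_fun n CR S w" and "\<And>H x. H \<in> S \<Longrightarrow> x < n \<Longrightarrow> w' H x = w H x"
  shows "color_fun n CR S w'"
  using assms unfolding color_fun_def by simp

lemma color_fun_same_color:
  assumes "color_fun n CR S w" and "same_color CR H x H' y"
    and "H \<in> S" "H' \<in> S" "x < n" "y < n"
  shows "w H x = w H' y"
  using assms unfolding color_fun_def same_color_def by metis

lemma cr_nbhd_same_color:
  assumes "S \<subseteq> cr_nbhd n CR G" and "H \<in> S" "H' \<in> S" and "x < n"
  shows "same_color CR H x H' x"
  using assms unfolding cr_nbhd_def same_color_def by (metis (mono_tags, lifting) mem_Collect_eq subsetD)

text \<open>A sum over all nodes is not computed from the color of one node. It is constant on
  \<open>S\<close> instead, since graphs of one neighborhood agree in color node by node, hence also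
  in \<open>w\<close>.\<close>

lemma color_fun_sum:
  fixes w :: "graph \<Rightarrow> nat \<Rightarrow> real"
  assumes S: "S \<subseteq> cr_nbhd n CR G" and w: "color_fun n CR S w"
  shows "color_fun n CR S (\<lambda>H x. \<Sum>y<n. w H y)"
proof (cases "S = {}")
  case False
  then obtain H0 where H0: "H0 \<in> S" by auto
  show ?thesis
  proof (rule color_fun_cong[OF color_fun_const])
    fix H and x :: nat assume H: "H \<in> S"
    show "(\<Sum>y<n. w H y) = (\<Sum>y<n. w H0 y)"
      by (intro sum.cong refl color_fun_same_color[OF w] cr_nbhd_same_color[OF S])
         (use H H0 in auto)
  qed
qed (simp add: color_fun_def)

section \<open>Neighborhood sums as functions of the colors\<close>

lemma N_in_bounded: "is_graph n H \<Longrightarrow> N_in H v \<subseteq> {..<n}"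
  and N_out_bounded: "is_graph n H \<Longrightarrow> N_out H v \<subseteq> {..<n}"
  by (auto simp: is_graph_def N_in_def N_out_def)

lemma sum_eq_mset_image:
  assumes "X \<subseteq> {..<n}" and "\<And>x. x < n \<Longrightarrow> w x = F (c x)"
  shows "sum w X = sum_mset (image_mset F (mset_image c X))"
proof -
  have "sum w X = (\<Sum>x\<in>X. F (c x))"
    using assms by (intro sum.cong) auto
  then show ?thesis
    by (simp add: mset_image_def sum_unfold_sum_mset multiset.map_comp comp_def)
qed

text \<open>An injective hash can be inverted, and the first component of the preimage is the
  previous color.\<close>

lemma refining_cr_in:
  assumes "inj hash"
  shows "refining (cr_in hash c0)"
  unfolding refining_def
  by (rule exI[of _ "\<lambda>c. fst (inv_into UNIV hash c)"]) (simp add: inv_f_f[OF assms])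

text \<open>One more round of refinement suffices: the preimage of the new color under the hash
  contains the multiset of the in-neighbors' colors, and summing \<open>F\<close> over it gives the
  sum of \<open>w\<close>.\<close>

lemma color_fun_in_sum:
  fixes w :: "graph \<Rightarrow> nat \<Rightarrow> real"
  assumes "inj hash" and "\<And>H. H \<in> S \<Longrightarrow> is_graph n H"
    and "color_fun n (cr_in hash c0) S w"
  shows "color_fun n (cr_in hash c0) S (\<lambda>H x. sum (w H) (N_in H x))"
proof -
  obtain t F where F: "\<forall>H\<in>S. \<forall>x<n. w H x = F (cr_in hash c0 H t x)"
    using assms(3) unfolding color_fun_def by blast
  have "\<forall>H\<in>S. \<forall>x<n. sum (w H) (N_in H x)
      = (\<lambda>c. sum_mset (image_mset F (snd (inv_into UNIV hash c)))) (cr_in hash c0 H (Suc t) x)"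
    using F by (auto simp: inv_f_f[OF assms(1)] intro!: sum_eq_mset_image N_in_bounded assms(2))
  then show ?thesis unfolding color_fun_def by (intro exI)
qed

lemma color_fun_in_out_sum:
  fixes w :: "graph \<Rightarrow> nat \<Rightarrow> real"
  assumes "inj hash" and "\<And>H. H \<in> S \<Longrightarrow> is_graph n H"
    and "color_fun n (cr_in_out hash c0) S w"
  shows "color_fun n (cr_in_out hash c0) S (\<lambda>H x. sum (w H) (N_in H x))"
    and "color_fun n (cr_in_out hash c0) S (\<lambda>H x. sum (w H) (N_out H x))"
proof -
  obtain t F where F: "\<forall>H\<in>S. \<forall>x<n. w H x = F (cr_in_out hash c0 H t x)"
    using assms(3) unfolding color_fun_def by blast
  have "\<forall>H\<in>S. \<forall>x<n. sum (w H) (N_in H x)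
      = (\<lambda>c. sum_mset (image_mset F (fst (snd (inv_into UNIV hash c))))) (cr_in_out hash c0 H (Suc t) x)"
    using F by (auto simp: inv_f_f[OF assms(1)] intro!: sum_eq_mset_image N_in_bounded assms(2))
  then show "color_fun n (cr_in_out hash c0) S (\<lambda>H x. sum (w H) (N_in H x))"
    unfolding color_fun_def by (intro exI)
  have "\<forall>H\<in>S. \<forall>x<n. sum (w H) (N_out H x)
      = (\<lambda>c. sum_mset (image_mset F (snd (snd (inv_into UNIV hash c))))) (cr_in_out hash c0 H (Suc t) x)"
    using F by (auto simp: inv_f_f[OF assms(1)] intro!: sum_eq_mset_image N_out_bounded assms(2))
  then show "color_fun n (cr_in_out hash c0) S (\<lambda>H x. sum (w H) (N_out H x))"
    unfolding color_fun_def by (intro exI)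
qed

text \<open>Turns the multiplicities of the weighted refinement into the coefficients of a
  matrix-vector product.\<close>

lemma image_sum_replicate_mset:
  assumes "finite X"
  shows "sum_mset (image_mset F (\<Sum>x\<in>X. replicate_mset (k x) (c x)))
    = (\<Sum>x\<in>X. of_nat (k x) * (F (c x) :: real))"
  using assms by induction auto

lemma color_fun_gram_sum:
  fixes w :: "graph \<Rightarrow> nat \<Rightarrow> real"
  assumes "inj hash" and w: "color_fun n (cr_gram n hash c0) S w"
  shows "color_fun n (cr_gram n hash c0) S
    (\<lambda>H x. \<Sum>y<n. real ((transpose_mat (adj n H) * adj n H) $$ (y, x)) * w H y)"
proof -
  obtain t F where F: "\<forall>H\<in>S. \<forall>x<n. w H x = F (cr_gram n hash c0 H t x)"
    using w unfolding color_fun_def by blast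
  have "\<forall>H\<in>S. \<forall>x<n. (\<Sum>y<n. real ((transpose_mat (adj n H) * adj n H) $$ (y, x)) * w H y)
      = (\<lambda>c. sum_mset (image_mset F (snd (inv_into UNIV hash c)))) (cr_gram n hash c0 H (Suc t) x)"
    using F
    by (simp add: cr_gram_def inv_f_f[OF assms(1)] image_sum_replicate_mset lessThan_atLeast0
             del: index_mult_mat(1))
  then show ?thesis unfolding color_fun_def by (intro exI)
qed


subsection \<open>Powers of color-respecting matrices\<close>

text \<open>Closure of the color functions under the matrix, so that it can be applied repeatedly;
  each application may raise the depth.\<close>

definition color_respecting ::
  "nat \<Rightarrow> (graph \<Rightarrow> nat \<Rightarrow> nat \<Rightarrow> 'c) \<Rightarrow> graph set \<Rightarrow> (graph \<Rightarrow> real mat) \<Rightarrow> bool" where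
  "color_respecting n CR S M \<longleftrightarrow> (\<forall>w. color_fun n CR S w \<longrightarrow>
     color_fun n CR S (\<lambda>H x. \<Sum>y<n. M H $$ (x, y) * w H y))"

lemma color_fun_pow_mat:
  assumes M: "\<And>H. H \<in> S \<Longrightarrow> M H \<in> carrier_mat n n" and "color_respecting n CR S M"
  shows "color_fun n CR S (\<lambda>H x. (M H ^\<^sub>m i *\<^sub>v ones n) $ x)"
proof (induction i)
  case 0
  show ?case
  proof (rule color_fun_cong[OF color_fun_const[of n CR S 1]])
    fix H x assume "H \<in> S" and "x < n"
    then have "M H ^\<^sub>m 0 *\<^sub>v ones n = ones n" using M[of H] by simp
    then show "(M H ^\<^sub>m 0 *\<^sub>v ones n) $ x = 1"
      using \<open>x < n\<close> by (simp add: ones_def)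
  qed
next
  case (Suc i)
  then have "color_fun n CR S (\<lambda>H x. \<Sum>y<n. M H $$ (x, y) * (M H ^\<^sub>m i *\<^sub>v ones n) $ y)"
    using assms(2) unfolding color_respecting_def by blast
  then show ?case
    by (rule color_fun_cong) (intro pow_mat_Suc_mult_vec_index M ones_carrier)
qed

text \<open>Every node has the same colors in \<open>H\<close> and \<open>H'\<close>, so the
  iterates of the all-ones vector coincide as vectors, and \<open>lam_max_mono\<close> applies in
  both directions.\<close>

lemma lam_max_eq:
  assumes S: "S \<subseteq> cr_nbhd n CR G" and n: "n > 0"
    and M: "\<And>H. H \<in> S \<Longrightarrow> M H \<in> carrier_mat n n" and resp: "color_respecting n CR S M"
    and nonneg: "\<And>H x y. H \<in> S \<Longrightarrow> x < n \<Longrightarrow> y < n \<Longrightarrow> 0 \<le> M H $$ (x, y)"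
    and H: "H \<in> S" "H' \<in> S"
  shows "lam_max (M H) = lam_max (M H')"
proof -
  have eq: "(M H ^\<^sub>m i *\<^sub>v ones n) $ x = (M H' ^\<^sub>m i *\<^sub>v ones n) $ x" if "x < n" for i x
    by (rule color_fun_same_color[OF color_fun_pow_mat[OF M resp] cr_nbhd_same_color[OF S H that]
          H that that])
  show ?thesis
  proof (rule antisym)
    show "lam_max (M H) \<le> lam_max (M H')"
      by (rule lam_max_mono[OF M[OF H(1)] M[OF H(2)] n nonneg[OF H(1)] eq_refl[OF eq]])
    show "lam_max (M H') \<le> lam_max (M H)"
      by (rule lam_max_mono[OF M[OF H(2)] M[OF H(1)] n nonneg[OF H(2)] eq_refl[OF eq[symmetric]]])
  qed
qed

text \<open>With equal normalizing factors and equal entries of the unnormalized iterates at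
  \<open>u\<close> and \<open>v\<close>, the two Cesaro sequences are the same sequence, hence so
  are their values under \<open>lim\<close>.\<close>

lemma centrality_eq:
  assumes S: "S \<subseteq> cr_nbhd n CR G"
    and M: "\<And>H. H \<in> S \<Longrightarrow> M H \<in> carrier_mat n n" and resp: "color_respecting n CR S M"
    and nonneg: "\<And>H x y. H \<in> S \<Longrightarrow> x < n \<Longrightarrow> y < n \<Longrightarrow> 0 \<le> M H $$ (x, y)"
    and H: "H \<in> S" "H' \<in> S" and uv: "u < n" "v < n"
    and same: "same_color CR H u H' v"
  shows "centrality (M H) u = centrality (M H') v"
proof -
  have l: "lam_max (M H) = lam_max (M H')"
    using uv(1) by (intro lam_max_eq[OF S _ M resp nonneg H]) simp
  have "(M H ^\<^sub>m i *\<^sub>v ones n) $ u = (M H' ^\<^sub>m i *\<^sub>v ones n) $ v" for i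
    by (rule color_fun_same_color[OF color_fun_pow_mat[OF M resp] same H uv])
  then have "cesaro (M H) u = cesaro (M H') v"
    using M[OF H(1)] M[OF H(2)] uv
    by (auto simp: cesaro_def l pow_smult_mat_mult_vec_index[OF _ ones_carrier]
             simp del: index_mult_mat_vec)
  then show ?thesis by (simp add: centrality_def)
qed


subsection \<open>The centrality matrices\<close>

lemma adj_row_sum:
  fixes w :: "nat \<Rightarrow> real"
  assumes "is_graph n E" and "x < n"
  shows "(\<Sum>y<n. adj n E $$ (x, y) * w y) = sum w (N_out E x)"
proof -
  have "(\<Sum>y<n. adj n E $$ (x, y) * w y) = (\<Sum>y<n. if y \<in> N_out E x then w y else 0)"
    using assms(2) by (intro sum.cong) (auto simp: adj_index N_out_def)
  also have "\<dots> = sum w (N_out E x)"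
    using N_out_bounded[OF assms(1)] by (simp add: sum.If_cases Int_absorb1)
  finally show ?thesis .
qed

lemma adj_column_sum:
  fixes w :: "nat \<Rightarrow> real"
  assumes "is_graph n E" and "x < n"
  shows "(\<Sum>y<n. adj n E $$ (y, x) * w y) = sum w (N_in E x)"
proof -
  have "(\<Sum>y<n. adj n E $$ (y, x) * w y) = (\<Sum>y<n. if y \<in> N_in E x then w y else 0)"
    using assms(2) by (intro sum.cong) (auto simp: adj_index N_in_def)
  also have "\<dots> = sum w (N_in E x)"
    using N_in_bounded[OF assms(1)] by (simp add: sum.If_cases Int_absorb1)
  finally show ?thesis .
qed

lemma M_EV_carrier [simp]: "M_EV n E \<in> carrier_mat n n"
  and M_auth_carrier [simp]: "M_auth n E \<in> carrier_mat n n"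
  and M_hub_carrier [simp]: "M_hub n E \<in> carrier_mat n n"
  and M_PR_carrier [simp]: "M_PR \<alpha> n E \<in> carrier_mat n n"
  by (simp_all add: M_EV_def M_auth_def M_hub_def M_PR_def Let_def mult_carrier_mat[of _ n n _ n])

lemma M_EV_index: "x < n \<Longrightarrow> y < n \<Longrightarrow> M_EV n E $$ (x, y) = adj n E $$ (y, x)"
  by (simp add: M_EV_def)

lemma M_auth_index:
  "x < n \<Longrightarrow> y < n \<Longrightarrow> M_auth n E $$ (x, y) = (\<Sum>k<n. adj n E $$ (k, x) * adj n E $$ (k, y))"
  by (simp add: M_auth_def scalar_prod_def lessThan_atLeast0)

lemma M_hub_index:
  "x < n \<Longrightarrow> y < n \<Longrightarrow> M_hub n E $$ (x, y) = (\<Sum>k<n. adj n E $$ (x, k) * adj n E $$ (y, k))"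
  by (simp add: M_hub_def scalar_prod_def lessThan_atLeast0)

text \<open>Links the row sums of the centrality to the column weights counted by color refinement:
  the Gram matrix is symmetric, and its version on the right has entries in the natural
  numbers.\<close>

lemma M_auth_gram:
  assumes "x < n" and "y < n"
  shows "M_auth n E $$ (x, y) = real ((transpose_mat (adj n E) * adj n E) $$ (y, x))"
  using assms
  by (simp add: M_auth_index scalar_prod_def lessThan_atLeast0 adj_index mult.commute)

lemma M_EV_row_sum:
  assumes "is_graph n E" and "x < n"
  shows "(\<Sum>y<n. M_EV n E $$ (x, y) * w y) = sum w (N_in E x)"
proof -
  have "(\<Sum>y<n. M_EV n E $$ (x, y) * w y) = (\<Sum>y<n. adj n E $$ (y, x) * w y)"
    using assms(2) by (intro sum.cong) (auto simp: M_EV_index)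
  then show ?thesis using assms by (simp only: adj_column_sum)
qed

text \<open>Multiplying by the adjacency matrix sums over out-neighbors, and multiplying by its
  transpose then sums over in-neighbors.\<close>

lemma M_auth_row_sum:
  assumes "is_graph n E" and "x < n"
  shows "(\<Sum>y<n. M_auth n E $$ (x, y) * w y) = (\<Sum>k\<in>N_in E x. sum w (N_out E k))"
proof -
  have "(\<Sum>y<n. M_auth n E $$ (x, y) * w y)
      = (\<Sum>y<n. \<Sum>k<n. adj n E $$ (k, x) * (adj n E $$ (k, y) * w y))"
    using assms(2) by (simp add: M_auth_index sum_distrib_right mult.assoc)
  also have "\<dots> = (\<Sum>k<n. adj n E $$ (k, x) * (\<Sum>y<n. adj n E $$ (k, y) * w y))"
    by (subst sum.swap) (simp add: sum_distrib_left)
  also have "\<dots> = (\<Sum>k<n. adj n E $$ (k, x) * sum w (N_out E k))"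
    using assms(1) by (simp add: adj_row_sum)
  finally show ?thesis using assms by (simp add: adj_column_sum)
qed

lemma M_hub_row_sum:
  assumes "is_graph n E" and "x < n"
  shows "(\<Sum>y<n. M_hub n E $$ (x, y) * w y) = (\<Sum>k\<in>N_out E x. sum w (N_in E k))"
proof -
  have "(\<Sum>y<n. M_hub n E $$ (x, y) * w y)
      = (\<Sum>y<n. \<Sum>k<n. adj n E $$ (x, k) * (adj n E $$ (y, k) * w y))"
    using assms(2) by (simp add: M_hub_index sum_distrib_right mult.assoc)
  also have "\<dots> = (\<Sum>k<n. adj n E $$ (x, k) * (\<Sum>y<n. adj n E $$ (y, k) * w y))"
    by (subst sum.swap) (simp add: sum_distrib_left)
  also have "\<dots> = (\<Sum>k<n. adj n E $$ (x, k) * sum w (N_in E k))"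
    using assms(1) by (simp add: adj_column_sum)
  finally show ?thesis using assms by (simp add: adj_row_sum)
qed

lemma deg_out_0_iff:
  assumes "is_graph n E"
  shows "deg_out E x = 0 \<longleftrightarrow> N_out E x = {}"
  using finite_subset[OF N_out_bounded[OF assms]] by (auto simp: deg_out_def)

text \<open>The row of a node without out-neighbors is zero, so adding 1 to it yields exactly the
  all-ones row of the augmented graph.\<close>

lemma adj_augment_index:
  assumes "is_graph n E" and "x < n" and "y < n"
  shows "adj n (augment n E) $$ (x, y) = (adj n E $$ (x, y) :: real) + of_bool (deg_out E x = 0)"
  using assms by (auto simp: adj_index augment_def deg_out_0_iff N_out_def)

lemma adj_augment_ones:
  assumes "is_graph n E" and "x < n"
  shows "(adj n (augment n E) *\<^sub>v ones n) $ x
    = real (if deg_out E x = 0 then n else deg_out E x)"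
proof -
  have "(adj n (augment n E) *\<^sub>v ones n) $ x = (\<Sum>y<n. adj n (augment n E) $$ (x, y))"
    using assms by (intro mult_ones_index) auto
  also have "\<dots> = (\<Sum>y<n. adj n E $$ (x, y) * 1 + of_bool (deg_out E x = 0))"
    using assms by (intro sum.cong) (auto simp: adj_augment_index)
  also have "\<dots> = real (deg_out E x) + real n * of_bool (deg_out E x = 0)"
    by (simp only: sum.distrib adj_row_sum[OF assms]) (simp add: deg_out_def)
  finally show ?thesis by simp
qed

lemma M_PR_index:
  assumes "is_graph n E" and "x < n" and "y < n"
  shows "M_PR \<alpha> n E $$ (x, y) =
    \<alpha> * ((adj n E $$ (y, x) + of_bool (deg_out E y = 0)) /
      real (if deg_out E y = 0 then n else deg_out E y)) + (1 - \<alpha>) / real n"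
  using assms
  by (simp add: M_PR_def Let_def mat_diag_mult_right[of _ n] adj_augment_ones adj_augment_index
           del: index_mult_mat_vec index_mult_mat(1) of_nat_eq_0_iff)

section \<open>The centrality matrices respect the colors\<close>

lemma color_respecting_EV:
  assumes "inj hash" and "\<And>H. H \<in> S \<Longrightarrow> is_graph n H"
  shows "color_respecting n (cr_in hash c0) S (M_EV n)"
  unfolding color_respecting_def
proof (intro allI impI)
  fix w :: "graph \<Rightarrow> nat \<Rightarrow> real" assume "color_fun n (cr_in hash c0) S w"
  from color_fun_in_sum[OF assms this]
  show "color_fun n (cr_in hash c0) S (\<lambda>H x. \<Sum>y<n. M_EV n H $$ (x, y) * w H y)"
    by (rule color_fun_cong) (simp_all add: M_EV_row_sum assms(2))
qed

text \<open>The product with \<open>M_PR\<close> splits into a sum over genuine in-neighbors, a sum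
  over the nodes of out-degree zero and a multiple of the total of \<open>w\<close>. The first costs
  one round of refinement; the other two are sums over all nodes, hence constant on
  \<open>S\<close>.\<close>

lemma color_respecting_PR:
  assumes "inj hash" and S: "S \<subseteq> cr_nbhd n (cr_in hash c0) G"
    and deg: "\<And>H H' x y. H \<in> S \<Longrightarrow> H' \<in> S \<Longrightarrow> x < n \<Longrightarrow> y < n \<Longrightarrow> c0 x = c0 y \<Longrightarrow>
      deg_out H x = deg_out H' y"
  shows "color_respecting n (cr_in hash c0) S (M_PR \<alpha> n)"
  unfolding color_respecting_def
proof (intro allI impI)
  let ?CR = "cr_in hash c0"
  fix w :: "graph \<Rightarrow> nat \<Rightarrow> real" assume w: "color_fun n ?CR S w"
  have graph: "is_graph n H" if "H \<in> S" for H
    using that S by (auto simp: cr_nbhd_def)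
  note map2 = color_fun_map2[OF refining_cr_in[OF assms(1)]]
  \<comment> \<open>The out-degree attached to an initial color; by \<open>deg\<close> the choice is
    immaterial, so out-degree is a color function at depth 0.\<close>
  define F where "F c = (SOME d. \<exists>H\<in>S. \<exists>x<n. c0 x = c \<and> d = deg_out H x)" for c
  have F: "deg_out H x = F (c0 x)" if Hx: "H \<in> S" "x < n" for H x
  proof -
    have "\<exists>d. \<exists>H'\<in>S. \<exists>y<n. c0 y = c0 x \<and> d = deg_out H' y" using Hx by blast
    from someI_ex[OF this, folded F_def] obtain H' y
      where "H' \<in> S" "y < n" "c0 y = c0 x" "F (c0 x) = deg_out H' y" by blast
    then show ?thesis using deg[OF Hx(1) _ Hx(2)] by metis
  qed
  have d: "color_fun n ?CR S deg_out"
    unfolding color_fun_def by (rule exI[of _ 0], rule exI[of _ F]) (simp add: F)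
  \<comment> \<open>The share of \<open>w\<close> that a node sends along each outgoing edge of the
    augmented graph, where a sink has \<open>n\<close> edges.\<close>
  define q where "q = (\<lambda>H x. w H x / real (if deg_out H x = 0 then n else deg_out H x))"
  have q: "color_fun n ?CR S q"
    unfolding q_def by (rule map2[OF w d])
  have qs: "color_fun n ?CR S (\<lambda>H x. of_bool (deg_out H x = 0) * q H x)"
    by (rule map2[OF d q])
  have "color_fun n ?CR S (\<lambda>H x.
     \<alpha> * (sum (q H) (N_in H x) + (\<Sum>y<n. of_bool (deg_out H y = 0) * q H y))
       + (1 - \<alpha>) / real n * (\<Sum>y<n. w H y))" (is "color_fun n ?CR S ?f")
    by (rule map2[OF map2[OF color_fun_in_sum[OF assms(1) graph q] color_fun_sum[OF S qs],
          where f = "\<lambda>x y. \<alpha> * (x + y)"] color_fun_sum[OF S w]])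
  then show "color_fun n ?CR S (\<lambda>H x. \<Sum>y<n. M_PR \<alpha> n H $$ (x, y) * w H y)"
  proof (rule color_fun_cong)
    fix H x assume H: "H \<in> S" and x: "x < n"
    have "M_PR \<alpha> n H $$ (x, y) * w H y
        = \<alpha> * (adj n H $$ (y, x) * q H y) + \<alpha> * (of_bool (deg_out H y = 0) * q H y)
          + (1 - \<alpha>) / real n * w H y" if "y < n" for y
      unfolding M_PR_index[OF graph[OF H] x that] q_def
      by (simp only: add_divide_distrib distrib_left distrib_right)
        (simp only: times_divide_eq_left times_divide_eq_right mult_ac)
    then have "(\<Sum>y<n. M_PR \<alpha> n H $$ (x, y) * w H y)
        = (\<Sum>y<n. \<alpha> * (adj n H $$ (y, x) * q H y) + \<alpha> * (of_bool (deg_out H y = 0) * q H y)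
          + (1 - \<alpha>) / real n * w H y)"
      by (intro sum.cong) auto
    also have "\<dots> = ?f H x"
      by (simp only: sum.distrib sum_distrib_left[symmetric] adj_column_sum[OF graph[OF H] x]
            distrib_left)
    finally show "(\<Sum>y<n. M_PR \<alpha> n H $$ (x, y) * w H y) = ?f H x" .
  qed
qed

lemma color_respecting_gram:
  assumes "inj hash"
  shows "color_respecting n (cr_gram n hash c0) S (M_auth n)"
  unfolding color_respecting_def
proof (intro allI impI)
  fix w :: "graph \<Rightarrow> nat \<Rightarrow> real" assume "color_fun n (cr_gram n hash c0) S w"
  from color_fun_gram_sum[OF assms this]
  show "color_fun n (cr_gram n hash c0) S (\<lambda>H x. \<Sum>y<n. M_auth n H $$ (x, y) * w H y)"
    by (rule color_fun_cong) (simp add: M_auth_gram del: index_mult_mat)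
qed

text \<open>Two rounds of refinement: one for the out-neighbor sum inside, one for the in-neighbor
  sum outside.\<close>

lemma color_respecting_auth:
  assumes "inj hash" and "\<And>H. H \<in> S \<Longrightarrow> is_graph n H"
  shows "color_respecting n (cr_in_out hash c0) S (M_auth n)"
  unfolding color_respecting_def
proof (intro allI impI)
  fix w :: "graph \<Rightarrow> nat \<Rightarrow> real" assume "color_fun n (cr_in_out hash c0) S w"
  note color_fun_in_out_sum(1)[OF assms color_fun_in_out_sum(2)[OF assms this]]
  then show "color_fun n (cr_in_out hash c0) S (\<lambda>H x. \<Sum>y<n. M_auth n H $$ (x, y) * w H y)"
    by (rule color_fun_cong) (simp_all add: M_auth_row_sum assms(2))
qed

lemma color_respecting_hub:
  assumes "inj hash" and "\<And>H. H \<in> S \<Longrightarrow> is_graph n H"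
  shows "color_respecting n (cr_in_out hash c0) S (M_hub n)"
  unfolding color_respecting_def
proof (intro allI impI)
  fix w :: "graph \<Rightarrow> nat \<Rightarrow> real" assume "color_fun n (cr_in_out hash c0) S w"
  note color_fun_in_out_sum(2)[OF assms color_fun_in_out_sum(1)[OF assms this]]
  then show "color_fun n (cr_in_out hash c0) S (\<lambda>H x. \<Sum>y<n. M_hub n H $$ (x, y) * w H y)"
    by (rule color_fun_cong) (simp_all add: M_hub_row_sum assms(2))
qed

text \<open>\<open>Gi\<close> and \<open>Gj\<close> range over both graphs, which covers comparisons
  within and across them. The refinement over both directions has its own hash because its arguments
  differ in type. Item 5 is split in two, so that each score is conditional on its own definedness
  only.\<close>

theorem theorem4p1:
  fixes n :: nat and G G1 G2 Gi Gj :: graph and u v :: nat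
    and c0 :: "nat \<Rightarrow> 'c"
    and hash :: "'c \<times> 'c multiset \<Rightarrow> 'c"
    and hash_io :: "'c \<times> 'c multiset \<times> 'c multiset \<Rightarrow> 'c"
    and a \<alpha> :: real
  assumes "is_graph n G"
    and "inj hash" and "inj hash_io"
    and "Gi \<in> {G1, G2}" and "Gj \<in> {G1, G2}"
    and "u < n" and "v < n"
  shows
    "(G1 \<in> cr_nbhd n (cr_in hash c0) G \<and>
      G2 \<in> cr_nbhd n (cr_in hash c0) G \<and>
      same_color (cr_in hash c0) Gi u Gj v \<and>
      a > 0 \<and>
      1 / a > lam_max (adj n G1) \<and>
      1 / a > lam_max (adj n G2)
      \<longrightarrow> katz a n Gi u = katz a n Gj v) \<and>
     (G1 \<in> cr_nbhd n (cr_in hash c0) G \<and>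
      G2 \<in> cr_nbhd n (cr_in hash c0) G \<and>
      same_color (cr_in hash c0) Gi u Gj v \<and>
      centrality_defined (M_EV n Gi) \<and>
      centrality_defined (M_EV n Gj)
      \<longrightarrow> centrality (M_EV n Gi) u = centrality (M_EV n Gj) v) \<and>
     (G1 \<in> cr_nbhd n (cr_in hash c0) G \<and>
      G2 \<in> cr_nbhd n (cr_in hash c0) G \<and>
      same_color (cr_in hash c0) Gi u Gj v \<and>
      (\<forall>H\<in>{G1, G2}. \<forall>H'\<in>{G1, G2}. \<forall>x<n. \<forall>y<n. c0 x = c0 y \<longrightarrow> deg_out H x = deg_out H' y) \<and>
      0 \<le> \<alpha> \<and>
      \<alpha> \<le> 1 \<and>
      centrality_defined (M_PR \<alpha> n Gi) \<and>
      centrality_defined (M_PR \<alpha> n Gj)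
      \<longrightarrow> centrality (M_PR \<alpha> n Gi) u = centrality (M_PR \<alpha> n Gj) v) \<and>
     (G1 \<in> cr_nbhd n (cr_gram n hash c0) G \<and>
      G2 \<in> cr_nbhd n (cr_gram n hash c0) G \<and>
      same_color (cr_gram n hash c0) Gi u Gj v \<and>
      centrality_defined (M_auth n Gi) \<and>
      centrality_defined (M_auth n Gj)
      \<longrightarrow> centrality (M_auth n Gi) u = centrality (M_auth n Gj) v) \<and>
     (G1 \<in> cr_nbhd n (cr_in_out hash_io c0) G \<and>
      G2 \<in> cr_nbhd n (cr_in_out hash_io c0) G \<and>
      same_color (cr_in_out hash_io c0) Gi u Gj v \<and>
      centrality_defined (M_auth n Gi) \<and>
      centrality_defined (M_auth n Gj)
      \<longrightarrow> centrality (M_auth n Gi) u = centrality (M_auth n Gj) v) \<and>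
     (G1 \<in> cr_nbhd n (cr_in_out hash_io c0) G \<and>
      G2 \<in> cr_nbhd n (cr_in_out hash_io c0) G \<and>
      same_color (cr_in_out hash_io c0) Gi u Gj v \<and>
      centrality_defined (M_hub n Gi) \<and>
      centrality_defined (M_hub n Gj)
      \<longrightarrow> centrality (M_hub n Gi) u = centrality (M_hub n Gj) v)"
proof -
  define S where "S = {G1, G2}"
  have H: "Gi \<in> S" "Gj \<in> S" using assms(4,5) by (auto simp: S_def)
  have graph: "is_graph n H" if "G1 \<in> cr_nbhd n CR G" "G2 \<in> cr_nbhd n CR G" "H \<in> S"
    for H and CR :: "graph \<Rightarrow> nat \<Rightarrow> nat \<Rightarrow> 'c"
    using that by (auto simp: S_def cr_nbhd_def)
  have EV: "0 \<le> M_EV n E $$ (x, y)" if "x < n" "y < n" for E x y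
    using that by (simp add: M_EV_index adj_index)
  have auth: "0 \<le> M_auth n E $$ (x, y)" if "x < n" "y < n" for E x y
    using that by (auto simp: M_auth_index adj_index intro!: sum_nonneg)
  have hub: "0 \<le> M_hub n E $$ (x, y)" if "x < n" "y < n" for E x y
    using that by (auto simp: M_hub_index adj_index intro!: sum_nonneg)
  \<comment> \<open>The bounds on \<open>\<alpha>\<close> make both summands of the PageRank matrix
    nonnegative.\<close>
  have PR: "0 \<le> M_PR \<alpha> n E $$ (x, y)"
    if "is_graph n E" "0 \<le> \<alpha>" "\<alpha> \<le> 1" "x < n" "y < n" for E x y
    using that by (simp add: M_PR_index adj_index)
  show ?thesis
  proof (intro conjI impI; elim conjE)
    assume nb: "G1 \<in> cr_nbhd n (cr_in hash c0) G" "G2 \<in> cr_nbhd n (cr_in hash c0) G"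
      and same: "same_color (cr_in hash c0) Gi u Gj v"
    note resp = color_respecting_EV[OF assms(2) graph[OF nb]]
    \<comment> \<open>Up to the factor \<open>a ^ k\<close> these are the terms of the Katz series,
      since transposition commutes with powers; the series therefore agree term by term.\<close>
    have "(M_EV n Gi ^\<^sub>m k *\<^sub>v ones n) $ u = (M_EV n Gj ^\<^sub>m k *\<^sub>v ones n) $ v" for k
      by (rule color_fun_same_color[OF color_fun_pow_mat[OF M_EV_carrier resp] same H assms(6,7)])
    then show "katz a n Gi u = katz a n Gj v"
      by (simp only: katz_def transpose_pow_mat[OF adj_carrier] M_EV_def)
  next
    assume nb: "G1 \<in> cr_nbhd n (cr_in hash c0) G" "G2 \<in> cr_nbhd n (cr_in hash c0) G"
      and same: "same_color (cr_in hash c0) Gi u Gj v"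
    have S: "S \<subseteq> cr_nbhd n (cr_in hash c0) G" using nb by (simp add: S_def)
    show "centrality (M_EV n Gi) u = centrality (M_EV n Gj) v"
      by (rule centrality_eq[OF S M_EV_carrier color_respecting_EV[OF assms(2) graph[OF nb]] EV
            H assms(6,7) same])
  next
    assume nb: "G1 \<in> cr_nbhd n (cr_in hash c0) G" "G2 \<in> cr_nbhd n (cr_in hash c0) G"
      and same: "same_color (cr_in hash c0) Gi u Gj v"
      and deg: "\<forall>H\<in>{G1, G2}. \<forall>H'\<in>{G1, G2}. \<forall>x<n. \<forall>y<n. c0 x = c0 y \<longrightarrow> deg_out H x = deg_out H' y"
      and \<alpha>: "0 \<le> \<alpha>" "\<alpha> \<le> 1"
    have S: "S \<subseteq> cr_nbhd n (cr_in hash c0) G" using nb by (simp add: S_def)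
    have resp: "color_respecting n (cr_in hash c0) S (M_PR \<alpha> n)"
      by (rule color_respecting_PR[OF assms(2) S]) (use deg in \<open>unfold S_def, blast\<close>)
    show "centrality (M_PR \<alpha> n Gi) u = centrality (M_PR \<alpha> n Gj) v"
      by (rule centrality_eq[OF S M_PR_carrier resp PR[OF graph[OF nb] \<alpha>] H assms(6,7) same])
  next
    assume nb: "G1 \<in> cr_nbhd n (cr_gram n hash c0) G" "G2 \<in> cr_nbhd n (cr_gram n hash c0) G"
      and same: "same_color (cr_gram n hash c0) Gi u Gj v"
    have S: "S \<subseteq> cr_nbhd n (cr_gram n hash c0) G" using nb by (simp add: S_def)
    show "centrality (M_auth n Gi) u = centrality (M_auth n Gj) v"
      by (rule centrality_eq[OF S M_auth_carrier color_respecting_gram[OF assms(2)] auth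
            H assms(6,7) same])
  next
    assume nb: "G1 \<in> cr_nbhd n (cr_in_out hash_io c0) G" "G2 \<in> cr_nbhd n (cr_in_out hash_io c0) G"
      and same: "same_color (cr_in_out hash_io c0) Gi u Gj v"
    have S: "S \<subseteq> cr_nbhd n (cr_in_out hash_io c0) G" using nb by (simp add: S_def)
    show "centrality (M_auth n Gi) u = centrality (M_auth n Gj) v"
      by (rule centrality_eq[OF S M_auth_carrier color_respecting_auth[OF assms(3) graph[OF nb]] auth
            H assms(6,7) same])
  next
    assume nb: "G1 \<in> cr_nbhd n (cr_in_out hash_io c0) G" "G2 \<in> cr_nbhd n (cr_in_out hash_io c0) G"
      and same: "same_color (cr_in_out hash_io c0) Gi u Gj v"
    have S: "S \<subseteq> cr_nbhd n (cr_in_out hash_io c0) G" using nb by (simp add: S_def)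
    show "centrality (M_hub n Gi) u = centrality (M_hub n Gj) v"
      by (rule centrality_eq[OF S M_hub_carrier color_respecting_hub[OF assms(3) graph[OF nb]] hub
            H assms(6,7) same])
  qed
qed

end
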